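(* Let $H$ and $G$ be finite simple undirected graphs (with nonempty vertex sets) and let $\mathcal K\in\{\mathcal{CP},\mathcal{CS}_+\}$. The $(H,G)$-homomorphism game admits a perfect $\mathcal K$-strategy if and only if there exists $X\in\mathcal K^{|V(H)\times V(G)|}$ such that (1) $\sum_{g\in V(G)}\sum_{g'\in V(G)}X[(h,g),(h',g')]=1$ for all $h,h'\in V(H)$, and (2) $X[(h,g),(h',g')]=0$ whenever ($h=h'$ and $g\ne g'$) or ($h\sim_H h'$ and $g\not\sim_G g'$).
   Context: $\mathcal{CP}^n$: $n\times n$ Gram matrices $(\langle x_i,x_j\rangle)$ of vectors $x_i\in\mathbb R^d_+$ (some $d\ge1$). $\mathcal{CS}_+^n$: matrices $(\mathrm{Tr}(X_iX_j))_{i,j=1}^n$ with $X_i$ real symmetric psd $d\times d$ matrices (some $d\ge1$). $\sim_H,\sim_G$ denote adjacency. A nonlocal game $(\pi,V)$ consists of finite question sets $S,T$, answer sets $A,B$, a probability distribution $\pi$ on $S\times T$ and a predicate $V:A\times B\times S\times T\to\{0,1\}$. The $(H,G)$-homomorphism game has $S=T=V(H)$, $A=B=V(G)$, $\pi$ uniform on $\{(h,h):h\in V(H)\}\cup\{(h,h'):h\sim_H h'\}$, and $V(g,g'|h,h')=0$ if ($h=h'$ and $g\neq g'$) or ($h\sim_H h'$ and ($g\not\sim_G g'$ or $g=g'$)), and $V(g,g'|h,h')=1$ otherwise. Perfect strategies. Let $N=|S||A|+|T||B|$; real symmetric $N\times N$ matrices are indexed by the disjoint union of $S\times A$ and $T\times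 B$ (when $S=T$, two disjoint copies are used). $\mathrm{Corr}(\mathcal K)$ is the set of vectors $p=(p(a,b|s,t))$ for which there is $X\in\mathcal K^N$ such that each block of $X$ indexed by a pair $i,j$ in the disjoint union of $S$ and $T$ has entries summing to $1$, and $X[(s,a),(t,b)]=p(a,b|s,t)$ for all $(s,a)\in S\times A$, $(t,b)\in T\times B$. The game admits a perfect $\mathcal K$-strategy if the supremum of $\sum_{s,t}\pi(s,t)\sum_{a,b}V(a,b|s,t)p(a,b|s,t)$ over $p\in\mathrm{Corr}(\mathcal K)$ equals $1$ and is achieved by some $p\in\mathrm{Corr}(\mathcal K)$. *)

theory Defs
  imports
    "HOL-Probability.Probability_Mass_Function"
    "Jordan_Normal_Form.Matrix"
    "Graph_Theory.Pair_Digraph"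
begin

section \<open>Matrix cones\<close>

text \<open>
  A real matrix whose rows and columns are indexed by a finite set \<open>I\<close> is a function
  \<open>'i \<Rightarrow> 'i \<Rightarrow> real\<close> of which only the entries in \<open>I \<times> I\<close> are relevant. For \<open>card I = n\<close> the sets
  below are the cones of \<open>n \<times> n\<close> matrices, up to the labelling of the rows and columns.
\<close>

definition psd_mat :: "nat \<Rightarrow> real Matrix.mat \<Rightarrow> bool" where
  "psd_mat d M \<longleftrightarrow> M \<in> carrier_mat d d \<and> transpose_mat M = M \<and>
     (\<forall>v \<in> carrier_vec d. scalar_prod v (mult_mat_vec M v) \<ge> 0)"

definition mat_trace :: "real Matrix.mat \<Rightarrow> real" where
  "mat_trace M = sum_list (diag_mat M)"

definition CP_cone :: "'i set \<Rightarrow> ('i \<Rightarrow> 'i \<Rightarrow> real) set" where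
  "CP_cone I = {X. \<exists>d \<ge> 1. \<exists>x :: 'i \<Rightarrow> real Matrix.vec.
     (\<forall>i \<in> I. x i \<in> carrier_vec d \<and> 0\<^sub>v d \<le> x i) \<and>
     (\<forall>i \<in> I. \<forall>j \<in> I. X i j = scalar_prod (x i) (x j))}"

definition CS_plus_cone :: "'i set \<Rightarrow> ('i \<Rightarrow> 'i \<Rightarrow> real) set" where
  "CS_plus_cone I = {X. \<exists>d \<ge> 1. \<exists>M :: 'i \<Rightarrow> real Matrix.mat.
     (\<forall>i \<in> I. psd_mat d (M i)) \<and>
     (\<forall>i \<in> I. \<forall>j \<in> I. X i j = mat_trace (M i * M j))}"

text \<open>
  The cone has to be used at several index types, so the choice between the two families is a
  datatype rather than a (necessarily monomorphic) set variable.
\<close>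

datatype cone_family = CP | CS_plus

fun matrix_cone :: "cone_family \<Rightarrow> 'i set \<Rightarrow> ('i \<Rightarrow> 'i \<Rightarrow> real) set" where
  "matrix_cone CP I = CP_cone I"
| "matrix_cone CS_plus I = CS_plus_cone I"

section \<open>Nonlocal games and perfect strategies\<close>

text \<open>\<open>wins \<G> a b s t\<close> stands for \<open>V(a,b|s,t) = 1\<close>.\<close>

record ('s, 't, 'a, 'b) game =
  questions1 :: "'s set"
  questions2 :: "'t set"
  answers1 :: "'a set"
  answers2 :: "'b set"
  question_dist :: "('s \<times> 't) pmf"
  wins :: "'a \<Rightarrow> 'b \<Rightarrow> 's \<Rightarrow> 't \<Rightarrow> bool"

locale nonlocal_game =
  fixes \<G> :: "('s, 't, 'a, 'b) game"
  assumes finite_questions1: "finite (questions1 \<G>)"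
    and finite_questions2: "finite (questions2 \<G>)"
    and finite_answers1: "finite (answers1 \<G>)"
    and finite_answers2: "finite (answers2 \<G>)"
    and question_dist_on: "set_pmf (question_dist \<G>) \<subseteq> questions1 \<G> \<times> questions2 \<G>"

definition strategy_index :: "('s, 't, 'a, 'b) game \<Rightarrow> ('s \<times> 'a + 't \<times> 'b) set" where
  "strategy_index \<G> = (questions1 \<G> \<times> answers1 \<G>) <+> (questions2 \<G> \<times> answers2 \<G>)"

fun question_block :: "('s, 't, 'a, 'b) game \<Rightarrow> 's + 't \<Rightarrow> ('s \<times> 'a + 't \<times> 'b) set" where
  "question_block \<G> (Inl s) = Inl ` ({s} \<times> answers1 \<G>)"
| "question_block \<G> (Inr t) = Inr ` ({t} \<times> answers2 \<G>)"

text \<open>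
  A correlation \<open>p\<close> is a function with \<open>p a b s t\<close> standing for \<open>p(a,b|s,t)\<close>; its values outside
  the question and answer sets are unconstrained and never used.
\<close>

definition Corr :: "cone_family \<Rightarrow> ('s, 't, 'a, 'b) game \<Rightarrow> ('a \<Rightarrow> 'b \<Rightarrow> 's \<Rightarrow> 't \<Rightarrow> real) set" where
  "Corr K \<G> = {p. \<exists>X \<in> matrix_cone K (strategy_index \<G>).
     (\<forall>i \<in> questions1 \<G> <+> questions2 \<G>. \<forall>j \<in> questions1 \<G> <+> questions2 \<G>.
        (\<Sum>k \<in> question_block \<G> i. \<Sum>l \<in> question_block \<G> j. X k l) = 1) \<and>
     (\<forall>s \<in> questions1 \<G>. \<forall>a \<in> answers1 \<G>. \<forall>t \<in> questions2 \<G>. \<forall>b \<in> answers2 \<G>.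
        X (Inl (s, a)) (Inr (t, b)) = p a b s t)}"

definition winning_prob ::
    "('s, 't, 'a, 'b) game \<Rightarrow> ('a \<Rightarrow> 'b \<Rightarrow> 's \<Rightarrow> 't \<Rightarrow> real) \<Rightarrow> real" where
  "winning_prob \<G> p =
     (\<Sum>s \<in> questions1 \<G>. \<Sum>t \<in> questions2 \<G>. pmf (question_dist \<G>) (s, t) *
        (\<Sum>a \<in> answers1 \<G>. \<Sum>b \<in> answers2 \<G>. of_bool (wins \<G> a b s t) * p a b s t))"

text \<open>The supremum is taken in \<open>ereal\<close>, where it is meaningful without side conditions.\<close>

definition perfect_strategy :: "cone_family \<Rightarrow> ('s, 't, 'a, 'b) game \<Rightarrow> bool" where
  "perfect_strategy K \<G> \<longleftrightarrow>
     (SUP p \<in> Corr K \<G>. ereal (winning_prob \<G> p)) = 1 \<and>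
     (\<exists>p \<in> Corr K \<G>. winning_prob \<G> p = 1)"

section \<open>The homomorphism game\<close>

text \<open>
  A finite simple undirected graph is a \<^const>\<open>pair_graph\<close>: \<open>parcs\<close> is its (symmetric,
  irreflexive) adjacency relation on the finite vertex set \<open>pverts\<close>.
\<close>

definition hom_game :: "'h pair_pre_digraph \<Rightarrow> 'g pair_pre_digraph \<Rightarrow> ('h, 'h, 'g, 'g) game" where
  "hom_game H G = \<lparr>
     questions1 = pverts H, questions2 = pverts H,
     answers1 = pverts G, answers2 = pverts G,
     question_dist = pmf_of_set ({(h, h) | h. h \<in> pverts H} \<union> {(h, h'). (h, h') \<in> parcs H}),
     wins = (\<lambda>g g' h h'. \<not> ((h = h' \<and> g \<noteq> g') \<or>
       ((h, h') \<in> parcs H \<and> ((g, g') \<notin> parcs G \<or> g = g')))) \<rparr>"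

lemma nonlocal_game_hom_game:
  assumes "pair_graph H" "pair_graph G" "pverts H \<noteq> {}"
  shows "nonlocal_game (hom_game H G)"
proof -
  interpret H: pair_graph H by fact
  interpret G: pair_graph G by fact
  let ?Q = "{(h, h) | h. h \<in> pverts H} \<union> {(h, h'). (h, h') \<in> parcs H}"
  have sub: "?Q \<subseteq> pverts H \<times> pverts H"
    by (auto dest: H.wellformed')
  have "finite ?Q"
    using sub by (rule finite_subset) (simp add: H.pair_finite_verts)
  moreover have "?Q \<noteq> {}"
    using assms(3) by auto
  ultimately have "set_pmf (pmf_of_set ?Q) = ?Q"
    by (intro set_pmf_of_set)
  with sub show ?thesis
    by unfold_locales (simp_all add: hom_game_def H.pair_finite_verts G.pair_finite_verts)
qed

end

theory Submission
  imports Defs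
begin

text \<open>
  Both cones consist of Gram matrices with nonnegative entries; for \<open>CS_plus\<close> nonnegativity means
  that \<open>Tr (A B) \<ge> 0\<close> for psd \<open>A\<close>, \<open>B\<close>. Let \<open>x h g\<close> and \<open>y h g\<close> be Gram vectors of the two
  players in a perfect strategy. The block sums force all the vectors \<open>\<Sum>g. x h g\<close> and
  \<open>\<Sum>g. y h g\<close> to be one and the same unit vector \<open>u\<close>. Since \<open>x h g\<close> is orthogonal to \<open>y h g'\<close> for
  \<open>g \<noteq> g'\<close>, we get \<open>\<langle>x h g, y h g\<rangle> = \<langle>x h g, u\<rangle> \<ge> \<langle>x h g, x h g\<rangle>\<close> and symmetrically, so
  \<open>x h g = y h g\<close>: the diagonal block of one player is the required matrix. Conversely, such a
  matrix becomes a strategy by giving both players the same vectors.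
\<close>

section \<open>The trace of a product of psd matrices\<close>

text \<open>
  Induction on the index set: a step of symmetric Gaussian elimination splits off a rank one
  summand of \<open>A\<close> and leaves a form that is psd on the smaller set.
\<close>

lemma sum_mult_psd_nonneg:
  fixes A B :: "'a \<Rightarrow> 'a \<Rightarrow> real"
  assumes "finite S"
    and "\<And>i j. i \<in> S \<Longrightarrow> j \<in> S \<Longrightarrow> A i j = A j i"
    and "\<And>x. 0 \<le> (\<Sum>i\<in>S. \<Sum>j\<in>S. A i j * x i * x j)"
    and "\<And>x. 0 \<le> (\<Sum>i\<in>S. \<Sum>j\<in>S. B i j * x i * x j)"
  shows "0 \<le> (\<Sum>i\<in>S. \<Sum>j\<in>S. A i j * B i j)"
  using assms
proof (induction S arbitrary: A rule: finite_induct)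
  case empty
  then show ?case by simp
next
  case (insert k S)
  note fin = \<open>finite S\<close> and kS = \<open>k \<notin> S\<close>
  have sym: "A i j = A j i" if "i \<in> insert k S" "j \<in> insert k S" for i j
    using insert.prems(1) that by blast
  have expand: "(\<Sum>i\<in>insert k S. \<Sum>j\<in>insert k S. f i j) =
      f k k + (\<Sum>j\<in>S. f k j) + (\<Sum>j\<in>S. f j k) + (\<Sum>i\<in>S. \<Sum>j\<in>S. f i j)" for f :: "'a \<Rightarrow> 'a \<Rightarrow> real"
    using fin kS by (simp add: sum.distrib)
  \<comment> \<open>The form of \<open>A\<close> at \<open>x\<close> with coordinate
    \<open>k\<close> set to \<open>c\<close>, written as a quadratic polynomial in \<open>c\<close>;
    every use below picks a suitable \<open>c\<close>.\<close>
  have form: "0 \<le> A k k * c\<^sup>2 + 2 * c * (\<Sum>j\<in>S. A k j * x j) + (\<Sum>i\<in>S. \<Sum>j\<in>S. A i j * x i * x j)"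
    for c x
  proof -
    let ?y = "x(k := c)"
    have ne: "(j = k) = False" if "j \<in> S" for j using that kS by auto
    have "(\<Sum>j\<in>S. A k j * ?y k * ?y j) = c * (\<Sum>j\<in>S. A k j * x j)"
      unfolding sum_distrib_left by (rule sum.cong) (auto simp: ne)
    moreover have "(\<Sum>j\<in>S. A j k * ?y j * ?y k) = c * (\<Sum>j\<in>S. A k j * x j)"
      unfolding sum_distrib_left by (rule sum.cong) (auto simp: ne sym)
    moreover have "(\<Sum>i\<in>S. \<Sum>j\<in>S. A i j * ?y i * ?y j) = (\<Sum>i\<in>S. \<Sum>j\<in>S. A i j * x i * x j)"
      by (intro sum.cong refl) (auto simp: ne)
    ultimately show ?thesis
      using insert.prems(2)[of ?y] unfolding expand by (simp add: power2_eq_square)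
  qed
  have B: "0 \<le> (\<Sum>i\<in>S. \<Sum>j\<in>S. B i j * x i * x j)" for x
  proof -
    let ?y = "x(k := 0)"
    have "(\<Sum>i\<in>S. \<Sum>j\<in>S. B i j * ?y i * ?y j) = (\<Sum>i\<in>S. \<Sum>j\<in>S. B i j * x i * x j)"
      using kS by (intro sum.cong refl) auto
    then show ?thesis
      using insert.prems(3)[of ?y] unfolding expand by simp
  qed
  have "0 \<le> A k k" using form[of 1 "\<lambda>_. 0"] by simp
  then consider "A k k = 0" | "0 < A k k" by linarith
  then show ?case
  proof cases
    case 1
    \<comment> \<open>With a zero pivot the form is affine in \<open>c\<close>, so a nonzero
      \<open>A k j\<close> would let it become negative.\<close>
    have row: "A k j = 0" if "j \<in> S" for j
    proof (rule ccontr)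
      assume ne: "A k j \<noteq> 0"
      let ?x = "\<lambda>i. if i = j then (1::real) else 0"
      \<comment> \<open>Chosen so that the form at the \<open>j\<close>-th unit vector plus
        \<open>c\<close> times the \<open>k\<close>-th takes the value -1.\<close>
      define c where "c = - (A j j + 1) / (2 * A k j)"
      have "(\<Sum>i\<in>S. A k i * ?x i) = A k j"
        using that fin by (simp add: if_distrib cong: if_cong)
      moreover have "(\<Sum>i\<in>S. \<Sum>l\<in>S. A i l * ?x i * ?x l) =
          (\<Sum>i\<in>S. \<Sum>l\<in>S. if l = j then if i = j then A j j else 0 else 0)"
        by (intro sum.cong refl) auto
      moreover have "\<dots> = A j j"
        using that fin by simp
      ultimately have "0 \<le> 2 * c * A k j + A j j"
        using form[of c ?x] 1 by simp
      moreover have "2 * c * A k j = - (A j j + 1)"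
        using ne by (simp add: c_def)
      ultimately show False by linarith
    qed
    have "A j k = 0" if "j \<in> S" for j using row that sym by simp
    then have "(\<Sum>i\<in>insert k S. \<Sum>j\<in>insert k S. A i j * B i j) = (\<Sum>i\<in>S. \<Sum>j\<in>S. A i j * B i j)"
      unfolding expand using 1 row by simp
    also have "\<dots> \<ge> 0"
      using form[of 0] by (intro insert.IH B) (auto simp: sym)
    finally show ?thesis .
  next
    case 2
    \<comment> \<open>The Schur complement of the pivot \<open>A k k\<close>.\<close>
    define A' where "A' i j = A i j - A k i * A k j / A k k" for i j
    have "0 \<le> (\<Sum>i\<in>S. \<Sum>j\<in>S. A' i j * x i * x j)" for x
    proof -
      let ?s = "\<Sum>j\<in>S. A k j * x j"
      have "?s * ?s / A k k = (\<Sum>i\<in>S. \<Sum>j\<in>S. A k i * A k j / A k k * x i * x j)"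
        unfolding sum_product sum_divide_distrib by (intro sum.cong refl) (simp add: mult_ac)
      then have "(\<Sum>i\<in>S. \<Sum>j\<in>S. A' i j * x i * x j) =
          (\<Sum>i\<in>S. \<Sum>j\<in>S. A i j * x i * x j) - ?s * ?s / A k k"
        by (simp add: A'_def left_diff_distrib sum_subtractf)
      moreover have "0 \<le> (\<Sum>i\<in>S. \<Sum>j\<in>S. A i j * x i * x j) - ?s * ?s / A k k"
        \<comment> \<open>This \<open>c\<close> minimizes the quadratic polynomial in
          \<open>form\<close>; the minimum is exactly the form of \<open>A'\<close> at
          \<open>x\<close>.\<close>
        using form[of "- ?s / A k k" x] 2 by (simp add: power2_eq_square)
      ultimately show ?thesis by simp
    qed
    moreover have "A' i j = A' j i" if "i \<in> S" "j \<in> S" for i j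
      using that sym by (simp add: A'_def mult.commute)
    ultimately have "0 \<le> (\<Sum>i\<in>S. \<Sum>j\<in>S. A' i j * B i j)"
      by (intro insert.IH B)
    \<comment> \<open>Row and column \<open>k\<close> of \<open>A'\<close> vanish, so enlarging the
      index set adds nothing.\<close>
    also have "\<dots> = (\<Sum>i\<in>insert k S. \<Sum>j\<in>insert k S. A' i j * B i j)"
      unfolding expand using 2 by (simp add: A'_def sym)
    finally have "0 \<le> (\<Sum>i\<in>insert k S. \<Sum>j\<in>insert k S. A' i j * B i j)" .
    \<comment> \<open>The rank one summand contributes the form of \<open>B\<close> at row
      \<open>k\<close> of \<open>A\<close>, divided by the positive pivot.\<close>
    moreover have "0 \<le> (\<Sum>i\<in>insert k S. \<Sum>j\<in>insert k S. B i j * A k i * A k j) / A k k"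
      using insert.prems(3)[of "A k"] 2 by (intro divide_nonneg_nonneg) auto
    moreover have "(\<Sum>i\<in>insert k S. \<Sum>j\<in>insert k S. A i j * B i j) =
        (\<Sum>i\<in>insert k S. \<Sum>j\<in>insert k S. A' i j * B i j) +
        (\<Sum>i\<in>insert k S. \<Sum>j\<in>insert k S. B i j * A k i * A k j) / A k k"
      unfolding sum_divide_distrib sum.distrib[symmetric]
      by (intro sum.cong refl) (simp add: A'_def algebra_simps)
    ultimately show ?thesis by linarith
  qed
qed

section \<open>Psd matrices through their entries\<close>

lemma psd_mat_sym:
  assumes "psd_mat d M" "a < d" "b < d"
  shows "M $$ (a, b) = M $$ (b, a)"
proof -
  have "M $$ (a, b) = transpose_mat M $$ (a, b)"
    using assms(1) by (simp add: psd_mat_def)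
  also have "\<dots> = M $$ (b, a)"
    using assms by (subst index_transpose_mat) (auto simp: psd_mat_def)
  finally show ?thesis .
qed

lemma psd_mat_quadratic_form:
  assumes "psd_mat d M"
  shows "0 \<le> (\<Sum>a<d. \<Sum>b<d. M $$ (a, b) * x a * x b)"
proof -
  have M: "M \<in> carrier_mat d d" using assms by (simp add: psd_mat_def)
  let ?v = "Matrix.vec d x"
  have "0 \<le> scalar_prod ?v (mult_mat_vec M ?v)"
    using assms by (simp add: psd_mat_def)
  also have "\<dots> = (\<Sum>a<d. \<Sum>b<d. M $$ (a, b) * x a * x b)"
    using M by (simp add: scalar_prod_def sum_distrib_left mult_ac lessThan_atLeast0)
  finally show ?thesis .
qed

text \<open>Symmetry of the second factor turns the trace into the entrywise inner product. This
  exhibits \<open>CS_plus\<close> matrices as Gram matrices and gives the trace the shape of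
  \<open>sum_mult_psd_nonneg\<close>.\<close>

lemma mat_trace_mult_psd:
  assumes "psd_mat d M" "psd_mat d N"
  shows "mat_trace (M * N) = (\<Sum>a<d. \<Sum>b<d. M $$ (a, b) * N $$ (a, b))"
proof -
  have MN: "M \<in> carrier_mat d d" "N \<in> carrier_mat d d"
    using assms by (auto simp: psd_mat_def)
  have "mat_trace (M * N) = (\<Sum>a<d. (M * N) $$ (a, a))"
    using MN by (simp add: mat_trace_def diag_mat_def sum_list_sum_nth lessThan_atLeast0)
  also have "\<dots> = (\<Sum>a<d. \<Sum>b<d. M $$ (a, b) * N $$ (b, a))"
    using MN by (intro sum.cong refl) (simp add: scalar_prod_def lessThan_atLeast0)
  also have "\<dots> = (\<Sum>a<d. \<Sum>b<d. M $$ (a, b) * N $$ (a, b))"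
    using psd_mat_sym[OF assms(2)] by (intro sum.cong refl) auto
  finally show ?thesis .
qed

section \<open>Common properties of the cones\<close>

text \<open>Composing the representing vectors or matrices with \<open>f\<close> represents the new
  matrix. As \<open>f\<close> may identify indices, this covers both passing to one player's block
  and duplicating a matrix for two players.\<close>

lemma matrix_cone_reindex:
  assumes "X \<in> matrix_cone K I" and "f ` J \<subseteq> I"
  shows "(\<lambda>i j. X (f i) (f j)) \<in> matrix_cone K J"
proof (cases K)
  case CP
  with assms obtain d x where "d \<ge> 1"
    "\<forall>i\<in>I. x i \<in> carrier_vec d \<and> 0\<^sub>v d \<le> (x i :: real Matrix.vec)"
    "\<forall>i\<in>I. \<forall>j\<in>I. X i j = scalar_prod (x i) (x j)"
    by (auto simp: CP_cone_def)
  with assms(2) CP show ?thesis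
    by (auto simp: CP_cone_def image_subset_iff intro!: exI[of _ d] exI[of _ "x \<circ> f"])
next
  case CS_plus
  with assms obtain d M where "d \<ge> 1" "\<forall>i\<in>I. psd_mat d (M i)"
    "\<forall>i\<in>I. \<forall>j\<in>I. X i j = mat_trace (M i * M j)"
    by (auto simp: CS_plus_cone_def)
  with assms(2) CS_plus show ?thesis
    by (auto simp: CS_plus_cone_def image_subset_iff intro!: exI[of _ d] exI[of _ "M \<circ> f"])
qed

text \<open>One coordinate type serves both cones: a psd matrix is read as the vector of its
  entries, and an ordinary vector gets a dummy second coordinate 0. Only inner products survive
  here; positivity is recovered by \<open>matrix_cone_nonneg\<close>.\<close>

lemma matrix_cone_gram:
  assumes "X \<in> matrix_cone K I"
  obtains L :: "(nat \<times> nat) set" and v where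
    "\<And>i j. i \<in> I \<Longrightarrow> j \<in> I \<Longrightarrow> X i j = (\<Sum>l\<in>L. v i l * v j l)" "finite L"
proof (cases K)
  case CP
  with assms obtain d x where x: "\<forall>i\<in>I. x i \<in> carrier_vec d \<and> 0\<^sub>v d \<le> (x i :: real Matrix.vec)"
    "\<forall>i\<in>I. \<forall>j\<in>I. X i j = scalar_prod (x i) (x j)"
    by (auto simp: CP_cone_def)
  show ?thesis
  proof (rule that[where L = "{..<d} \<times> {0}" and v = "\<lambda>i l. vec_index (x i) (fst l)"])
    fix i j assume "i \<in> I" "j \<in> I"
    with x have "X i j = (\<Sum>a<d. vec_index (x i) a * vec_index (x j) a)"
      by (auto simp: scalar_prod_def lessThan_atLeast0)
    also have "\<dots> = (\<Sum>l\<in>{..<d} \<times> {0}. vec_index (x i) (fst l) * vec_index (x j) (fst l))"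
      by (rule sum.reindex_bij_witness[of _ fst "\<lambda>a. (a, 0)"]) auto
    finally show "X i j = (\<Sum>l\<in>{..<d} \<times> {0}. vec_index (x i) (fst l) * vec_index (x j) (fst l))" .
  qed simp
next
  case CS_plus
  with assms obtain d M where M: "\<forall>i\<in>I. psd_mat d (M i)"
    "\<forall>i\<in>I. \<forall>j\<in>I. X i j = mat_trace (M i * M j)"
    by (auto simp: CS_plus_cone_def)
  show ?thesis
  proof (rule that[where L = "{..<d} \<times> {..<d}" and v = "\<lambda>i l. M i $$ l"])
    fix i j assume "i \<in> I" "j \<in> I"
    with M have "X i j = (\<Sum>a<d. \<Sum>b<d. M i $$ (a, b) * M j $$ (a, b))"
      by (simp add: mat_trace_mult_psd[of d])
    also have "\<dots> = (\<Sum>l\<in>{..<d} \<times> {..<d}. M i $$ l * M j $$ l)"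
      unfolding sum.cartesian_product by (rule sum.cong) auto
    finally show "X i j = (\<Sum>l\<in>{..<d} \<times> {..<d}. M i $$ l * M j $$ l)" .
  qed simp
qed

lemma matrix_cone_nonneg:
  assumes "X \<in> matrix_cone K I" "i \<in> I" "j \<in> I"
  shows "0 \<le> X i j"
proof (cases K)
  case CP
  with assms(1) obtain d x where
    "\<forall>i\<in>I. x i \<in> carrier_vec d \<and> 0\<^sub>v d \<le> (x i :: real Matrix.vec)"
    "\<forall>i\<in>I. \<forall>j\<in>I. X i j = scalar_prod (x i) (x j)"
    by (auto simp: CP_cone_def)
  then have x: "x i \<in> carrier_vec d" "0\<^sub>v d \<le> x i"
    "x j \<in> carrier_vec d" "0\<^sub>v d \<le> x j" "X i j = scalar_prod (x i) (x j)"
    using assms(2,3) by blast+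
  have "0 \<le> vec_index (x i) a * vec_index (x j) a" if "a < d" for a
    using x that by (intro mult_nonneg_nonneg) (auto simp: less_eq_vec_def)
  then have "0 \<le> (\<Sum>a = 0..<d. vec_index (x i) a * vec_index (x j) a)"
    by (intro sum_nonneg) simp
  then show ?thesis
    using x by (simp add: scalar_prod_def)
next
  case CS_plus
  with assms(1) obtain d M where "\<forall>i\<in>I. psd_mat d (M i)"
    "\<forall>i\<in>I. \<forall>j\<in>I. X i j = mat_trace (M i * M j)"
    by (auto simp: CS_plus_cone_def)
  then have M: "psd_mat d (M i)" "psd_mat d (M j)" "X i j = mat_trace (M i * M j)"
    using assms(2,3) by blast+
  show ?thesis
    unfolding M(3) mat_trace_mult_psd[OF M(1,2)]
    by (rule sum_mult_psd_nonneg)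
      (simp_all only: psd_mat_quadratic_form[OF M(1)] psd_mat_quadratic_form[OF M(2)]
        finite_lessThan lessThan_iff psd_mat_sym[OF M(1)])
qed

section \<open>Perfect strategies\<close>

lemma sum_question_block:
  "sum f (question_block \<G> (Inl s)) = (\<Sum>a\<in>answers1 \<G>. f (Inl (s, a)))"
  "sum f (question_block \<G> (Inr t)) = (\<Sum>b\<in>answers2 \<G>. f (Inr (t, b)))"
proof -
  have "question_block \<G> (Inl s) = (\<lambda>a. Inl (s, a)) ` answers1 \<G>" by auto
  then show "sum f (question_block \<G> (Inl s)) = (\<Sum>a\<in>answers1 \<G>. f (Inl (s, a)))"
    by (simp del: question_block.simps add: sum.reindex inj_on_def)
  have "question_block \<G> (Inr t) = (\<lambda>b. Inr (t, b)) ` answers2 \<G>" by auto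
  then show "sum f (question_block \<G> (Inr t)) = (\<Sum>b\<in>answers2 \<G>. f (Inr (t, b)))"
    by (simp del: question_block.simps add: sum.reindex inj_on_def)
qed

section \<open>Correlations and the winning probability\<close>

lemma Corr_nonneg:
  assumes "p \<in> Corr K \<G>" "s \<in> questions1 \<G>" "t \<in> questions2 \<G>" "a \<in> answers1 \<G>" "b \<in> answers2 \<G>"
  shows "0 \<le> p a b s t"
proof -
  obtain X where X: "X \<in> matrix_cone K (strategy_index \<G>)"
    "X (Inl (s, a)) (Inr (t, b)) = p a b s t"
    using assms unfolding Corr_def by blast
  then show ?thesis
    using matrix_cone_nonneg[OF X(1), of "Inl (s, a)" "Inr (t, b)"] assms
    by (auto simp: strategy_index_def)
qed

lemma Corr_sum:
  assumes "p \<in> Corr K \<G>" "s \<in> questions1 \<G>" "t \<in> questions2 \<G>"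
  shows "(\<Sum>a\<in>answers1 \<G>. \<Sum>b\<in>answers2 \<G>. p a b s t) = 1"
proof -
  obtain X where X:
    "\<forall>i \<in> questions1 \<G> <+> questions2 \<G>. \<forall>j \<in> questions1 \<G> <+> questions2 \<G>.
        (\<Sum>k \<in> question_block \<G> i. \<Sum>l \<in> question_block \<G> j. X k l) = 1"
    "\<forall>a\<in>answers1 \<G>. \<forall>b\<in>answers2 \<G>. X (Inl (s, a)) (Inr (t, b)) = p a b s t"
    using assms unfolding Corr_def by blast
  have "(\<Sum>k \<in> question_block \<G> (Inl s). \<Sum>l \<in> question_block \<G> (Inr t). X k l) = 1"
    using X(1) assms by blast
  then show ?thesis
    using X(2) by (simp add: sum_question_block del: question_block.simps)
qed

context nonlocal_game
begin

text \<open>Both \<open>p\<close> (for each question pair) and the question distribution have total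
  mass 1, so winning is the complement of losing.\<close>

lemma winning_prob_Corr:
  assumes "p \<in> Corr K \<G>"
  shows "winning_prob \<G> p = 1 - (\<Sum>s\<in>questions1 \<G>. \<Sum>t\<in>questions2 \<G>. \<Sum>a\<in>answers1 \<G>. \<Sum>b\<in>answers2 \<G>.
    pmf (question_dist \<G>) (s, t) * (of_bool (\<not> wins \<G> a b s t) * p a b s t))"
proof -
  have split: "(\<Sum>a\<in>answers1 \<G>. \<Sum>b\<in>answers2 \<G>. of_bool (wins \<G> a b s t) * p a b s t) =
      1 - (\<Sum>a\<in>answers1 \<G>. \<Sum>b\<in>answers2 \<G>. of_bool (\<not> wins \<G> a b s t) * p a b s t)"
    if "s \<in> questions1 \<G>" "t \<in> questions2 \<G>" for s t
    unfolding Corr_sum[OF assms that, symmetric] sum_subtractf[symmetric]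
    by (intro sum.cong refl) auto
  have "(\<Sum>s\<in>questions1 \<G>. \<Sum>t\<in>questions2 \<G>. pmf (question_dist \<G>) (s, t)) = 1"
    using sum_pmf_eq_1[OF _ question_dist_on]
    by (simp add: sum.cartesian_product finite_questions1 finite_questions2)
  then show ?thesis
    unfolding winning_prob_def
    by (simp add: split right_diff_distrib sum_subtractf sum_distrib_left cong: sum.cong)
qed

text \<open>The losing probability is a sum of nonnegative terms, hence zero iff every term is.
  Since no correlation wins with probability above 1, attaining 1 already makes the supremum
  1.\<close>

lemma perfect_strategy_iff:
  "perfect_strategy K \<G> \<longleftrightarrow> (\<exists>p \<in> Corr K \<G>. \<forall>(s, t) \<in> set_pmf (question_dist \<G>).
     \<forall>a \<in> answers1 \<G>. \<forall>b \<in> answers2 \<G>. \<not> wins \<G> a b s t \<longrightarrow> p a b s t = 0)"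
proof -
  have nonneg: "0 \<le> pmf (question_dist \<G>) (s, t) * (of_bool (\<not> wins \<G> a b s t) * p a b s t)"
    if "p \<in> Corr K \<G>" "s \<in> questions1 \<G>" "t \<in> questions2 \<G>" "a \<in> answers1 \<G>" "b \<in> answers2 \<G>"
    for p s t a b
    using Corr_nonneg[OF that] by simp
  have le: "winning_prob \<G> p \<le> 1" if "p \<in> Corr K \<G>" for p
    unfolding winning_prob_Corr[OF that] using nonneg[OF that] by (simp add: sum_nonneg)
  have eq: "winning_prob \<G> p = 1 \<longleftrightarrow> (\<forall>(s, t) \<in> set_pmf (question_dist \<G>).
      \<forall>a \<in> answers1 \<G>. \<forall>b \<in> answers2 \<G>. \<not> wins \<G> a b s t \<longrightarrow> p a b s t = 0)"
    if "p \<in> Corr K \<G>" for p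
  proof -
    have "winning_prob \<G> p = 1 \<longleftrightarrow> (\<forall>s\<in>questions1 \<G>. \<forall>t\<in>questions2 \<G>. \<forall>a\<in>answers1 \<G>. \<forall>b\<in>answers2 \<G>.
        pmf (question_dist \<G>) (s, t) * (of_bool (\<not> wins \<G> a b s t) * p a b s t) = 0)"
      unfolding winning_prob_Corr[OF that] using nonneg[OF that]
      by (simp add: sum_nonneg_eq_0_iff sum_nonneg finite_questions1 finite_questions2
          finite_answers1 finite_answers2 del: mult_eq_0_iff)
    also have "\<dots> \<longleftrightarrow> (\<forall>(s, t) \<in> set_pmf (question_dist \<G>).
      \<forall>a \<in> answers1 \<G>. \<forall>b \<in> answers2 \<G>. \<not> wins \<G> a b s t \<longrightarrow> p a b s t = 0)"
      \<comment> \<open>Question pairs off the support have weight 0; those on it are legitimate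
        questions with nonzero weight.\<close>
      using question_dist_on by (fastforce simp: set_pmf_iff)
    finally show ?thesis .
  qed
  have "(SUP p \<in> Corr K \<G>. ereal (winning_prob \<G> p)) = 1"
    if "p \<in> Corr K \<G>" "winning_prob \<G> p = 1" for p
    using that le by (intro antisym SUP_least SUP_upper2[OF that(1)]) auto
  then show ?thesis
    unfolding perfect_strategy_def using eq by blast
qed

end

section \<open>The homomorphism game\<close>

lemma vectors_eq_of_inner_ge:
  fixes u w :: "'l \<Rightarrow> real"
  assumes "finite L" and "l \<in> L"
    and "(\<Sum>l\<in>L. u l * u l) + (\<Sum>l\<in>L. w l * w l) \<le> 2 * (\<Sum>l\<in>L. u l * w l)"
  shows "u l = w l"
proof -
  \<comment> \<open>Expand the squared distance; the assumption makes it nonpositive.\<close>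
  have "(\<Sum>l\<in>L. (u l - w l)\<^sup>2) =
      (\<Sum>l\<in>L. u l * u l) + (\<Sum>l\<in>L. w l * w l) - 2 * (\<Sum>l\<in>L. u l * w l)"
    unfolding sum_distrib_left sum.distrib[symmetric] sum_subtractf[symmetric]
    by (intro sum.cong refl) (simp add: power2_eq_square algebra_simps)
  then have "(\<Sum>l\<in>L. (u l - w l)\<^sup>2) = 0"
    using assms(3) sum_nonneg[of L "\<lambda>l. (u l - w l)\<^sup>2"] by simp
  then show ?thesis
    using assms(1,2) by (simp add: sum_nonneg_eq_0_iff)
qed

text \<open>Here \<open>x\<close> and \<open>y\<close> are the two players' vectors for one common
  question. Block sums supply \<open>sums\<close>, the cone supplies \<open>nonneg\<close>, and
  consistency on equal questions supplies \<open>orth\<close>.\<close>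

lemma resolutions_eq:
  fixes x y :: "'g \<Rightarrow> 'l \<Rightarrow> real"
  defines "ip \<equiv> \<lambda>L u w :: 'l \<Rightarrow> real. \<Sum>l\<in>L. u l * w l"
  assumes fin: "finite V" "finite L"
    and sums: "(\<Sum>g\<in>V. \<Sum>g'\<in>V. ip L (x g) (x g')) = 1" "(\<Sum>g\<in>V. \<Sum>g'\<in>V. ip L (x g) (y g')) = 1"
      "(\<Sum>g\<in>V. \<Sum>g'\<in>V. ip L (y g) (y g')) = 1"
    and nonneg: "\<And>g g'. g \<in> V \<Longrightarrow> g' \<in> V \<Longrightarrow> 0 \<le> ip L (x g) (x g')"
      "\<And>g g'. g \<in> V \<Longrightarrow> g' \<in> V \<Longrightarrow> 0 \<le> ip L (y g) (y g')"
    and orth: "\<And>g g'. g \<in> V \<Longrightarrow> g' \<in> V \<Longrightarrow> g \<noteq> g' \<Longrightarrow> ip L (x g) (y g') = 0"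
    and "g \<in> V" "l \<in> L"
  shows "x g l = y g l"
proof -
  define ux where "ux l = (\<Sum>g\<in>V. x g l)" for l
  define uy where "uy l = (\<Sum>g\<in>V. y g l)" for l
  have ip_sum: "ip L w (\<lambda>l. \<Sum>g\<in>V. z g l) = (\<Sum>g\<in>V. ip L w (z g))" for w and z :: "'g \<Rightarrow> 'l \<Rightarrow> real"
    unfolding ip_def sum_distrib_left by (rule sum.swap)
  have comm: "ip L w z = ip L z w" for w z
    by (simp add: ip_def mult.commute)
  have sum_ip: "ip L (\<lambda>l. \<Sum>g\<in>V. z g l) w = (\<Sum>g\<in>V. ip L (z g) w)" for w and z :: "'g \<Rightarrow> 'l \<Rightarrow> real"
    using ip_sum[of w z] by (simp only: comm[of w])
  \<comment> \<open>Two unit vectors with inner product 1 are at distance 0.\<close>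
  have "ip L ux ux = 1" "ip L ux uy = 1" "ip L uy uy = 1"
    unfolding ux_def uy_def sum_ip ip_sum by (fact sums)+
  then have u: "ux l = uy l" if "l \<in> L" for l
    using vectors_eq_of_inner_ge[OF fin(2) that, of ux uy] by (simp add: ip_def)
  then have ip_u: "ip L w ux = ip L w uy" for w
    by (simp add: ip_def)
  \<comment> \<open>The left side is one of the nonnegative summands of the right; trading
    \<open>ux\<close> for \<open>uy\<close> then lets orthogonality remove all terms but
    \<open>g' = g\<close>.\<close>
  have "ip L (x g) (x g) \<le> ip L (x g) ux"
    unfolding ux_def ip_sum using nonneg(1) \<open>g \<in> V\<close> fin by (intro member_le_sum) auto
  also have "\<dots> = (\<Sum>g'\<in>V. ip L (x g) (y g'))"
    unfolding ip_u uy_def ip_sum ..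
  also have "\<dots> = (\<Sum>g'\<in>V. if g' = g then ip L (x g) (y g) else 0)"
    using orth \<open>g \<in> V\<close> by (intro sum.cong) auto
  finally have 1: "ip L (x g) (x g) \<le> ip L (x g) (y g)"
    using \<open>g \<in> V\<close> fin by simp
  have "ip L (y g) (y g) \<le> ip L (y g) uy"
    unfolding uy_def ip_sum using nonneg(2) \<open>g \<in> V\<close> fin by (intro member_le_sum) auto
  also have "\<dots> = (\<Sum>g'\<in>V. ip L (x g') (y g))"
    unfolding ip_u[symmetric] ux_def ip_sum by (simp add: comm)
  also have "\<dots> = (\<Sum>g'\<in>V. if g' = g then ip L (x g) (y g) else 0)"
    using orth \<open>g \<in> V\<close> by (intro sum.cong) auto
  finally have "ip L (y g) (y g) \<le> ip L (x g) (y g)"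
    using \<open>g \<in> V\<close> fin by simp
  with 1 show ?thesis
    using vectors_eq_of_inner_ge[OF fin(2) \<open>l \<in> L\<close>, of "x g" "y g"] by (simp add: ip_def)
qed

section \<open>From perfect correlations to matrices and back\<close>

lemma set_question_dist_hom_game:
  assumes "pair_graph H" and "pverts H \<noteq> {}"
  shows "set_pmf (question_dist (hom_game H G)) =
    {(h, h') \<in> pverts H \<times> pverts H. h = h' \<or> (h, h') \<in> parcs H}"
proof -
  interpret H: pair_graph H by fact
  let ?Q = "{(h, h) | h. h \<in> pverts H} \<union> {(h, h'). (h, h') \<in> parcs H}"
  have Q: "?Q = {(h, h') \<in> pverts H \<times> pverts H. h = h' \<or> (h, h') \<in> parcs H}"
    by (auto dest: H.wellformed')
  moreover have "finite ?Q"
    unfolding Q by (rule finite_subset[of _ "pverts H \<times> pverts H"]) (auto simp: H.pair_finite_verts)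
  moreover have "?Q \<noteq> {}" using assms(2) by auto
  ultimately show ?thesis
    by (simp add: hom_game_def)
qed

theorem corollary5p13:
  fixes H :: "'h pair_pre_digraph" and G :: "'g pair_pre_digraph" and K :: cone_family
  assumes "pair_graph H" and "pair_graph G"
    and "pverts H \<noteq> {}" and "pverts G \<noteq> {}"
  shows "perfect_strategy K (hom_game H G) \<longleftrightarrow>
    (\<exists>X \<in> matrix_cone K (pverts H \<times> pverts G).
       (\<forall>h \<in> pverts H. \<forall>h' \<in> pverts H.
          (\<Sum>g \<in> pverts G. \<Sum>g' \<in> pverts G. X (h, g) (h', g')) = 1) \<and>
       (\<forall>h \<in> pverts H. \<forall>h' \<in> pverts H. \<forall>g \<in> pverts G. \<forall>g' \<in> pverts G.
          (h = h' \<and> g \<noteq> g') \<or> ((h, h') \<in> parcs H \<and> (g, g') \<notin> parcs G) \<longrightarrow>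
          X (h, g) (h', g') = 0))"
    (is "_ \<longleftrightarrow> ?R")
proof -
  interpret H: pair_graph H by fact
  interpret G: pair_graph G by fact
  let ?\<G> = "hom_game H G"
  let ?lose = "\<lambda>h h' g g'. (h = h' \<and> g \<noteq> g') \<or> ((h, h') \<in> parcs H \<and> (g, g') \<notin> parcs G)"
  interpret nonlocal_game ?\<G>
    using assms by (intro nonlocal_game_hom_game)
  have game [simp]: "questions1 ?\<G> = pverts H" "questions2 ?\<G> = pverts H"
    "answers1 ?\<G> = pverts G" "answers2 ?\<G> = pverts G"
    by (simp_all add: hom_game_def)
  \<comment> \<open>The game also rejects equal answers to adjacent questions; as \<open>G\<close>
    has no loops, nonadjacency of the answers includes that case.\<close>
  have lose: "\<not> wins ?\<G> g g' h h' \<longleftrightarrow> ?lose h h' g g'" for g g' h h'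
    using G.no_loops' by (auto simp: hom_game_def)
  have index: "Inl i \<in> strategy_index ?\<G> \<longleftrightarrow> i \<in> pverts H \<times> pverts G"
    "Inr i \<in> strategy_index ?\<G> \<longleftrightarrow> i \<in> pverts H \<times> pverts G" for i
    by (auto simp: strategy_index_def)
  have perfect: "perfect_strategy K ?\<G> \<longleftrightarrow> (\<exists>p \<in> Corr K ?\<G>.
      \<forall>h \<in> pverts H. \<forall>h' \<in> pverts H. \<forall>g \<in> pverts G. \<forall>g' \<in> pverts G.
        ?lose h h' g g' \<longrightarrow> p g g' h h' = 0)"
    unfolding perfect_strategy_iff set_question_dist_hom_game[OF assms(1,3)] lose game
    by (intro bex_cong refl) blast
  show ?thesis
  proof
    assume "perfect_strategy K ?\<G>"
    then obtain p where p: "p \<in> Corr K ?\<G>" and zero: "\<And>h h' g g'. h \<in> pverts H \<Longrightarrow> h' \<in> pverts H \<Longrightarrow>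
        g \<in> pverts G \<Longrightarrow> g' \<in> pverts G \<Longrightarrow> ?lose h h' g g' \<Longrightarrow> p g g' h h' = 0"
      unfolding perfect by blast
    from p obtain X where X: "X \<in> matrix_cone K (strategy_index ?\<G>)"
      and blocks: "\<And>i j. i \<in> pverts H <+> pverts H \<Longrightarrow> j \<in> pverts H <+> pverts H \<Longrightarrow>
        (\<Sum>k \<in> question_block ?\<G> i. \<Sum>l \<in> question_block ?\<G> j. X k l) = 1"
      and Xp: "\<And>h h' g g'. h \<in> pverts H \<Longrightarrow> h' \<in> pverts H \<Longrightarrow> g \<in> pverts G \<Longrightarrow> g' \<in> pverts G \<Longrightarrow>
        X (Inl (h, g)) (Inr (h', g')) = p g g' h h'"
      unfolding Corr_def game by blast
    obtain L :: "(nat \<times> nat) set" and v where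
      v: "\<And>i j. i \<in> strategy_index ?\<G> \<Longrightarrow> j \<in> strategy_index ?\<G> \<Longrightarrow> X i j = (\<Sum>l\<in>L. v i l * v j l)"
      and L: "finite L"
      using matrix_cone_gram[OF X] by metis
    \<comment> \<open>Apply \<open>resolutions_eq\<close> to the blocks of the two copies of
      \<open>h\<close>.\<close>
    have same: "v (Inl (h, g)) l = v (Inr (h, g)) l"
      if "h \<in> pverts H" "g \<in> pverts G" "l \<in> L" for h g l
    proof (rule resolutions_eq[OF G.pair_finite_verts L _ _ _ _ _ _ that(2,3)])
      have h: "Inl h \<in> pverts H <+> pverts H" "Inr h \<in> pverts H <+> pverts H"
        using that by auto
      have ip: "(\<Sum>l\<in>L. v i l * v j l) = X i j"
        if "i \<in> strategy_index ?\<G>" "j \<in> strategy_index ?\<G>" for i j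
        using v that by simp
      show "(\<Sum>g\<in>pverts G. \<Sum>g'\<in>pverts G. \<Sum>l\<in>L. v (Inl (h, g)) l * v (Inl (h, g')) l) = 1"
        "(\<Sum>g\<in>pverts G. \<Sum>g'\<in>pverts G. \<Sum>l\<in>L. v (Inl (h, g)) l * v (Inr (h, g')) l) = 1"
        "(\<Sum>g\<in>pverts G. \<Sum>g'\<in>pverts G. \<Sum>l\<in>L. v (Inr (h, g)) l * v (Inr (h, g')) l) = 1"
        using blocks[OF h(1) h(1)] blocks[OF h(1) h(2)] blocks[OF h(2) h(2)] \<open>h \<in> pverts H\<close>
        by (simp_all add: ip index sum_question_block del: question_block.simps)
      fix g g' assume g: "g \<in> pverts G" "g' \<in> pverts G"
      show "0 \<le> (\<Sum>l\<in>L. v (Inl (h, g)) l * v (Inl (h, g')) l)"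
        "0 \<le> (\<Sum>l\<in>L. v (Inr (h, g)) l * v (Inr (h, g')) l)"
        using g \<open>h \<in> pverts H\<close> matrix_cone_nonneg[OF X] by (simp_all add: ip index)
      assume "g \<noteq> g'"
      then show "(\<Sum>l\<in>L. v (Inl (h, g)) l * v (Inr (h, g')) l) = 0"
        using g \<open>h \<in> pverts H\<close> zero Xp by (simp add: ip index)
    qed
    \<comment> \<open>The witness is the first player's diagonal block.\<close>
    have "(\<lambda>i j. X (Inl i) (Inl j)) \<in> matrix_cone K (pverts H \<times> pverts G)"
      using X by (rule matrix_cone_reindex) (auto simp: index)
    moreover have "(\<Sum>g \<in> pverts G. \<Sum>g' \<in> pverts G. X (Inl (h, g)) (Inl (h', g'))) = 1"
      if "h \<in> pverts H" "h' \<in> pverts H" for h h'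
      using blocks[of "Inl h" "Inl h'"] that
      by (simp add: sum_question_block InlI del: question_block.simps)
    moreover have "X (Inl (h, g)) (Inl (h', g')) = 0"
      if "h \<in> pverts H" "h' \<in> pverts H" "g \<in> pverts G" "g' \<in> pverts G" "?lose h h' g g'" for h h' g g'
    proof -
      \<comment> \<open>Replacing the second vector by its twin turns the entry into a value of
        \<open>p\<close>, which vanishes on losing answers.\<close>
      have "X (Inl (h, g)) (Inl (h', g')) = X (Inl (h, g)) (Inr (h', g'))"
        using that(1-4) by (simp add: v index same)
      then show ?thesis using zero[OF that] Xp that(1-4) by simp
    qed
    ultimately show ?R
      by (intro bexI[of _ "\<lambda>i j. X (Inl i) (Inl j)"]) blast+
  next
    assume ?R
    then obtain X where X: "X \<in> matrix_cone K (pverts H \<times> pverts G)"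
      and sums: "\<forall>h \<in> pverts H. \<forall>h' \<in> pverts H.
        (\<Sum>g \<in> pverts G. \<Sum>g' \<in> pverts G. X (h, g) (h', g')) = 1"
      and zero: "\<forall>h \<in> pverts H. \<forall>h' \<in> pverts H. \<forall>g \<in> pverts G. \<forall>g' \<in> pverts G.
        ?lose h h' g g' \<longrightarrow> X (h, g) (h', g') = 0"
      by (elim bexE conjE) (rule that)
    \<comment> \<open>\<open>?f\<close> forgets which player an index belongs to, so
      \<open>?Y\<close> consists of four copies of \<open>X\<close>, and each of its block sums is
      one of \<open>sums\<close>.\<close>
    let ?f = "case_sum id id :: 'h \<times> 'g + 'h \<times> 'g \<Rightarrow> 'h \<times> 'g"
    let ?Y = "\<lambda>i j. X (?f i) (?f j)"
    have "?Y \<in> matrix_cone K (strategy_index ?\<G>)"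
      using X by (rule matrix_cone_reindex) (auto simp: strategy_index_def)
    moreover have "\<forall>i \<in> pverts H <+> pverts H. \<forall>j \<in> pverts H <+> pverts H.
        (\<Sum>k \<in> question_block ?\<G> i. \<Sum>l \<in> question_block ?\<G> j. ?Y k l) = 1"
      by (auto simp: sum_question_block sums simp del: question_block.simps)
    ultimately have "(\<lambda>g g' h h'. X (h, g) (h', g')) \<in> Corr K ?\<G>"
      unfolding Corr_def by (auto intro!: bexI[of _ ?Y] simp del: question_block.simps)
    then show "perfect_strategy K ?\<G>"
      unfolding perfect by (rule bexI[rotated]) (rule zero)
  qed
qed

end
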